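(* For all $n\ge2$ and $0\le k<n$ there is a bijection $$\phi_{n,k}:\mathcal{D}^{\mathrm{III}}_{2n,2k+2}\to\mathcal{D}^{\mathrm{III}}_{2n,2k}\cup\bigcup_{i=k}^{n-1}\mathcal{D}^{\mathrm{III}}_{2n-2,2i}.$$
   Context: For $m\ge1$, $\mathcal{D}^{\mathrm{III}}_{2m}$ (Dumont permutations of the third kind) is the set of permutations $\sigma=\sigma_1\cdots\sigma_{2m}$ of $[2m]$ such that whenever $\sigma_i>\sigma_{i+1}$, both $\sigma_i$ and $\sigma_{i+1}$ are even. For $j\ge1$, $\mathcal{D}^{\mathrm{III}}_{2m,2j}$ is the set of $\sigma\in\mathcal{D}^{\mathrm{III}}_{2m}$ whose leftmost even letter is $2j$; $\mathcal{D}^{\mathrm{III}}_{2m,0}=\emptyset$. (The sets on the right-hand side are pairwise disjoint.) *)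

theory Defs
  imports Main "HOL-Combinatorics.Multiset_Permutations"
begin

text \<open>Permutations of \<open>{1..2m}\<close> are words in one-line notation; list positions start at 0.
  The parameters are the halves: \<open>dumont3 m\<close> consists of words of length \<open>2m\<close>.\<close>

definition dumont3 :: "nat \<Rightarrow> nat list set" where
  "dumont3 m = {\<sigma> \<in> permutations_of_set {1..2*m}.
     \<forall>i. Suc i < length \<sigma> \<longrightarrow> \<sigma> ! i > \<sigma> ! Suc i \<longrightarrow> even (\<sigma> ! i) \<and> even (\<sigma> ! Suc i)}"

text \<open>\<open>find even \<sigma>\<close> is the leftmost even letter of \<open>\<sigma>\<close>, if there is one.\<close>

definition dumont3_first :: "nat \<Rightarrow> nat \<Rightarrow> nat list set" where
  "dumont3_first m j =
     (if j = 0 then {} else {\<sigma> \<in> dumont3 m. find even \<sigma> = Some (2*j)})"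

end

theory Submission
  imports Defs
begin

text \<open>
  Since all sets are finite, it suffices to compare cardinalities. Let \<open>c\<close> be the number of even
  letters above all odd letters of an alphabet; such letters are interchangeable, and inserting the
  next odd letter \<open>v\<close> means placing it in front of one of the \<open>c\<close> letters above it or at the end,
  except directly after a letter above it. Counting the exceptional placements by deleting one such
  letter gives a linear recurrence in \<open>c\<close>, with operator \<open>S\<close> while \<open>v\<close> is below the first even letter
  \<open>2j\<close> and \<open>T\<close> afterwards. So the number of Dumont permutations with first even letter \<open>2j\<close> is
  \<open>(T ^^ (n - j)) ((S ^^ (j - 1)) fact) 0\<close>, and with \<open>R = S - T\<close> the theorem follows from \<open>T R = R S + T\<close>,
  \<open>T fact = R fact\<close> and \<open>(R u) 0 = u 0\<close>.
\<close>

section \<open>Linked words with a prescribed first even letter\<close>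

definition link :: "nat \<Rightarrow> nat \<Rightarrow> bool" where
  "link a b \<longleftrightarrow> (a > b \<longrightarrow> even a \<and> even b)"

text \<open>The alphabet is an arbitrary set because the count inserts odd letters one at a time and
  deletes even ones.\<close>

definition words :: "nat set \<Rightarrow> nat \<Rightarrow> nat list set" where
  "words A e = {w \<in> permutations_of_set A. successively link w \<and> find even w = Some e}"

lemma words_iff:
  "w \<in> words A e \<longleftrightarrow> set w = A \<and> distinct w \<and> successively link w \<and> find even w = Some e"
  by (auto simp: words_def permutations_of_set_def)

lemma finite_words [simp]: "finite (words A e)"
  unfolding words_def by (rule finite_subset[OF _ finite_permutations_of_set[of A]]) auto

lemma find_append:
  "find P (xs @ ys) = (case find P xs of None \<Rightarrow> find P ys | Some x \<Rightarrow> Some x)"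
  by (induction xs) auto

text \<open>Each letter of \<open>M\<close> occurs exactly once in every word, so splitting a word
  at such a letter amounts to choosing the word and the letter independently.\<close>

lemma
  assumes "M \<subseteq> A" "finite A"
  shows finite_marked_words: "finite {(us, y, vs). us @ y # vs \<in> words A e \<and> y \<in> M}" (is "finite ?X")
    and card_marked_words:
      "card {(us, y, vs). us @ y # vs \<in> words A e \<and> y \<in> M} = card M * card (words A e)"
proof -
  have bij: "bij_betw (\<lambda>(us, y, vs). (y, us @ y # vs))
          {(us, y, vs). us @ y # vs \<in> words A e \<and> y \<in> M} (M \<times> words A e)"
    unfolding bij_betw_def
  proof (intro conjI equalityI subsetI)
    show "inj_on (\<lambda>(us, y, vs). (y, us @ y # vs)) {(us, y, vs). us @ y # vs \<in> words A e \<and> y \<in> M}"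
      by (auto simp: inj_on_def words_iff append_Cons_eq_iff)
  next
    fix p assume "p \<in> M \<times> words A e"
    then obtain y w where p: "p = (y, w)" "y \<in> M" "w \<in> words A e" by auto
    then have "y \<in> set w" using assms by (auto simp: words_iff)
    then obtain us vs where "w = us @ y # vs" by (meson split_list)
    then show "p \<in> (\<lambda>(us, y, vs). (y, us @ y # vs)) ` {(us, y, vs). us @ y # vs \<in> words A e \<and> y \<in> M}"
      using p by (auto intro!: image_eqI[of _ _ "(us, y, vs)"])
  qed auto
  have "finite M" using assms finite_subset by blast
  then show "finite ?X" using bij_betw_finite[OF bij] by simp
  show "card ?X = card M * card (words A e)"
    using bij_betw_same_card[OF bij] by (simp add: card_cartesian_product)
qed

section \<open>Inserting the next odd letter\<close>

lemma successively_link_snoc: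
  assumes "even z" "\<And>x. x \<in> set w \<Longrightarrow> odd x \<Longrightarrow> x < z"
  shows "successively link (w @ [z]) \<longleftrightarrow> successively link w"
proof (cases w rule: rev_cases)
  case (snoc u x)
  have "link x z" using assms(2)[of x] assms(1) by (cases "even x") (auto simp: snoc link_def)
  then show ?thesis by (auto simp: snoc successively_append_iff)
qed simp

text \<open>If \<open>vs\<close> starts with an odd letter, that letter is below both
  \<open>y\<close> and \<open>z\<close>, so both sides fail; otherwise all affected adjacencies join
  even letters.\<close>

lemma successively_link_insert:
  assumes "even y" "even z"
    and "\<And>x. x \<in> set vs \<Longrightarrow> odd x \<Longrightarrow> x < y" "\<And>x. x \<in> set vs \<Longrightarrow> odd x \<Longrightarrow> x < z"
  shows "successively link (us @ y # z # vs) \<longleftrightarrow> successively link (us @ y # vs)"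
  using assms by (cases vs) (auto simp: successively_append_iff link_def)

text \<open>
  The sum counts the exceptional pairs (word, place): the place directly follows a letter of \<open>L\<close> and
  is either the end of the word or directly before a letter of \<open>L\<close>. Deleting the letter after the
  place, or the last letter for the place at the end, loses a letter \<open>z\<close> of \<open>L\<close> that is not the first
  even letter. The assumption \<open>other\<close> excludes that the last letter is the first even one.
\<close>
lemma card_words_insert_odd:
  fixes A :: "nat set" and v e :: nat
  defines "L \<equiv> {x \<in> A. x > v}"
  assumes fin: "finite A" and v: "odd v" "v \<notin> A" and evL: "\<And>x. x \<in> L \<Longrightarrow> even x"
    and other: "\<exists>x\<in>A. even x \<and> x \<noteq> e"
  shows "card (words (insert v A) e) + (\<Sum>z\<in>L - {e}. card L * card (words (A - {z}) e))
           = (card L + 1) * card (words A e)"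
proof -
  \<comment> \<open>\<open>I\<close> collects the candidate places for \<open>v\<close>,
    \<open>I0\<close> the admissible ones, \<open>Z1\<close> and \<open>Z2\<close> the exceptional
    ones inside and at the end of a word.\<close>
  define I where "I = {(us, vs). us @ vs \<in> words A e \<and> (vs = [] \<or> hd vs \<in> L)}"
  define I0 where "I0 = {(us, vs) \<in> I. us = [] \<or> last us \<notin> L}"
  define Z1 where "Z1 = {(us, vs) \<in> I. us \<noteq> [] \<and> last us \<in> L \<and> vs \<noteq> []}"
  define Z2 where "Z2 = {(us, vs) \<in> I. us \<noteq> [] \<and> last us \<in> L \<and> vs = []}"
  define Sp where "Sp B M = {(us, y, vs). us @ y # vs \<in> words B e \<and> y \<in> M}" for B M
  have finL: "finite L" and LA: "L \<subseteq> A" using fin by (auto simp: L_def)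
  \<comment> \<open>Odd letters of \<open>A\<close> lie below \<open>v\<close>, since the letters
    above \<open>v\<close> are even.\<close>
  have small: "x < z" if "x \<in> A" "odd x" "z \<in> L" for x z
    using evL[of x] that v unfolding L_def by (auto dest: evL) (metis linorder_neqE_nat order.strict_trans)
  have cardSp: "card (Sp B M) = card M * card (words B e)" if "M \<subseteq> B" "finite B" for B M
    unfolding Sp_def by (rule card_marked_words) fact+
  have finSp: "finite (Sp B M)" if "M \<subseteq> B" "finite B" for B M
    unfolding Sp_def by (rule finite_marked_words) fact+

  have bijI: "bij_betw (case_sum (\<lambda>w. (w, [])) (\<lambda>(us, y, vs). (us, y # vs))) (words A e <+> Sp A L) I"
    unfolding bij_betw_def
  proof (intro conjI equalityI subsetI)
    show "inj_on (case_sum (\<lambda>w. (w, [])) (\<lambda>(us, y, vs). (us, y # vs))) (words A e <+> Sp A L)"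
      by (auto simp: inj_on_def)
  next
    fix p assume "p \<in> I"
    then obtain us vs where p: "p = (us, vs)" "us @ vs \<in> words A e" "vs = [] \<or> hd vs \<in> L"
      by (auto simp: I_def)
    show "p \<in> case_sum (\<lambda>w. (w, [])) (\<lambda>(us, y, vs). (us, y # vs)) ` (words A e <+> Sp A L)"
    proof (cases vs)
      case Nil
      then show ?thesis using p by (auto intro!: image_eqI[of _ _ "Inl us"])
    next
      case (Cons y vs')
      then show ?thesis using p by (auto simp: Sp_def intro!: image_eqI[of _ _ "Inr (us, y, vs')"])
    qed
  qed (auto simp: I_def Sp_def)
  have cardI: "card I = (card L + 1) * card (words A e)"
    using bij_betw_same_card[OF bijI] cardSp[OF LA fin] finSp[OF LA fin] by (simp add: card_Plus)
  have finI: "finite I"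
    using bij_betw_finite[OF bijI] finSp[OF LA fin] by simp

  \<comment> \<open>The odd \<open>v\<close> tolerates no descent on either side, so its neighbours
    satisfy \<open>last us < v < hd vs\<close>, and removing it leaves an ascent.\<close>
  have "bij_betw (\<lambda>(us, vs). us @ v # vs) I0 (words (insert v A) e)"
    unfolding bij_betw_def
  proof (intro conjI equalityI subsetI)
    have "v \<notin> set us \<and> v \<notin> set vs" if "(us, vs) \<in> I0" for us vs
      using that v by (auto simp: I0_def I_def words_iff)
    then show "inj_on (\<lambda>(us, vs). us @ v # vs) I0"
      by (fastforce simp: inj_on_def append_Cons_eq_iff)
  next
    fix w assume "w \<in> (\<lambda>(us, vs). us @ v # vs) ` I0"
    then obtain us vs where w: "w = us @ v # vs" "us @ vs \<in> words A e"
      "vs = [] \<or> hd vs \<in> L" "us = [] \<or> last us \<notin> L"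
      by (auto simp: I_def I0_def)
    have "us = [] \<or> last us < v"
      using w(2,4) v by (auto simp: L_def words_iff) (metis Un_iff last_in_set linorder_neqE_nat)
    then show "w \<in> words (insert v A) e"
      using w v by (auto simp: words_iff successively_append_iff successively_Cons link_def L_def
          find_append split: option.splits)
  next
    fix w assume w: "w \<in> words (insert v A) e"
    then obtain us vs where us: "w = us @ v # vs"
      by (metis insertI1 split_list words_iff)
    have sets: "set us \<union> set vs = A" using w us v by (auto simp: words_iff)
    have 1: "us = [] \<or> last us < v"
      using w v by (auto simp: us words_iff successively_append_iff link_def)
        (metis last_in_set linorder_neqE_nat)
    have 2: "vs = [] \<or> hd vs > v"
      using w v by (cases vs) (auto simp: us words_iff successively_append_iff link_def)
    have "us @ vs \<in> words A e"
      using w v 1 2 sets by (auto simp: us words_iff successively_append_iff successively_Cons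
          link_def find_append split: option.splits)
    moreover have "vs = [] \<or> hd vs \<in> L" "us = [] \<or> last us \<notin> L"
      using 1 2 sets by (auto simp: L_def)
    ultimately show "w \<in> (\<lambda>(us, vs). us @ v # vs) ` I0"
      by (auto simp: us I0_def I_def)
  qed
  then have card0: "card I0 = card (words (insert v A) e)" by (rule bij_betw_same_card)

  \<comment> \<open>The place lies between \<open>y\<close> and \<open>z\<close>; deleting
    \<open>z\<close> leaves a word in which the letter \<open>y\<close> of \<open>L - {z}\<close> is
    marked.\<close>
  have "bij_betw (\<lambda>(z, us, y, vs). (us @ [y], z # vs)) (SIGMA z:L - {e}. Sp (A - {z}) (L - {z})) Z1"
    unfolding bij_betw_def
  proof (intro conjI equalityI subsetI)
    show "inj_on (\<lambda>(z, us, y, vs). (us @ [y], z # vs)) (SIGMA z:L - {e}. Sp (A - {z}) (L - {z}))"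
      by (auto simp: inj_on_def)
  next
    fix p assume "p \<in> (\<lambda>(z, us, y, vs). (us @ [y], z # vs)) ` (SIGMA z:L - {e}. Sp (A - {z}) (L - {z}))"
    then obtain z us y vs where p: "p = (us @ [y], z # vs)" "z \<in> L" "z \<noteq> e" "y \<in> L" "y \<noteq> z"
      "us @ y # vs \<in> words (A - {z}) e"
      by (auto simp: Sp_def)
    have vsA: "set vs \<subseteq> A" using p by (auto simp: words_iff)
    have "successively link (us @ y # z # vs) \<longleftrightarrow> successively link (us @ y # vs)"
      using p evL small vsA by (intro successively_link_insert) auto
    then have "us @ y # z # vs \<in> words A e"
      using p evL LA by (auto simp: words_iff find_append split: option.splits)
    then show "p \<in> Z1" using p by (auto simp: Z1_def I_def)
  next
    fix p assume "p \<in> Z1"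
    then obtain us y z vs where p: "p = (us @ [y], z # vs)" "z \<in> L" "y \<in> L"
      "us @ y # z # vs \<in> words A e"
      by (auto simp: Z1_def I_def neq_Nil_conv) (metis append_butlast_last_id append_assoc append_Cons append_Nil)
    have vsA: "set vs \<subseteq> A" using p by (auto simp: words_iff)
    have "successively link (us @ y # z # vs) \<longleftrightarrow> successively link (us @ y # vs)"
      using p evL small vsA by (intro successively_link_insert) auto
    then have "us @ y # vs \<in> words (A - {z}) e"
      using p evL LA by (auto simp: words_iff find_append split: option.splits)
    \<comment> \<open>The even letter \<open>y\<close> stands before \<open>z\<close>, so
      \<open>z\<close> is not the first even letter.\<close>
    moreover have "z \<noteq> e"
    proof
      assume "z = e"
      have "find even (us @ y # z # vs) = Some e" "distinct (us @ y # z # vs)"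
        using p by (auto simp: words_iff)
      then show False
        using \<open>z = e\<close> evL[OF p(3)] by (auto simp: find_append find_Some_iff split: option.splits)
    qed
    moreover have "y \<noteq> z" using p by (auto simp: words_iff)
    ultimately show "p \<in> (\<lambda>(z, us, y, vs). (us @ [y], z # vs)) `
        (SIGMA z:L - {e}. Sp (A - {z}) (L - {z}))"
      using p by (auto simp: Sp_def intro!: image_eqI[of _ _ "(z, us, y, vs)"])
  qed
  then have "card Z1 = card (SIGMA z:L - {e}. Sp (A - {z}) (L - {z}))"
    by (rule bij_betw_same_card[symmetric])
  also have "\<dots> = (\<Sum>z\<in>L - {e}. card (Sp (A - {z}) (L - {z})))"
    using finL fin LA by (intro card_SigmaI ballI finSp) auto
  also have "\<dots> = (\<Sum>z\<in>L - {e}. (card L - 1) * card (words (A - {z}) e))"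
  proof (rule sum.cong)
    fix z assume "z \<in> L - {e}"
    then show "card (Sp (A - {z}) (L - {z})) = (card L - 1) * card (words (A - {z}) e)"
      using cardSp[of "L - {z}" "A - {z}"] LA fin finL by auto
  qed auto
  finally have card1: "card Z1 = (\<Sum>z\<in>L - {e}. (card L - 1) * card (words (A - {z}) e))" .

  have "bij_betw (\<lambda>(z, w). (w @ [z], [])) (SIGMA z:L - {e}. words (A - {z}) e) Z2"
    unfolding bij_betw_def
  proof (intro conjI equalityI subsetI)
    show "inj_on (\<lambda>(z, w). (w @ [z], [])) (SIGMA z:L - {e}. words (A - {z}) e)"
      by (auto simp: inj_on_def)
  next
    fix p :: "nat list \<times> nat list"
    assume "p \<in> (\<lambda>(z, w). (w @ [z], [])) ` (SIGMA z:L - {e}. words (A - {z}) e)"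
    then obtain z w where p: "p = (w @ [z], [])" "z \<in> L" "z \<noteq> e" "w \<in> words (A - {z}) e"
      by auto
    have "successively link (w @ [z]) \<longleftrightarrow> successively link w"
      using p evL small by (intro successively_link_snoc) (auto simp: words_iff)
    then have "w @ [z] \<in> words A e"
      using p LA by (auto simp: words_iff find_append)
    then show "p \<in> Z2" using p by (auto simp: Z2_def I_def)
  next
    fix p assume "p \<in> Z2"
    then obtain us where us: "p = (us, [])" "us \<noteq> []" "last us \<in> L" "us \<in> words A e"
      by (auto simp: Z2_def I_def)
    define w z where "w = butlast us" and "z = last us"
    have p: "p = (w @ [z], [])" "z \<in> L" "w @ [z] \<in> words A e"
      using us by (auto simp: w_def z_def)
    have "successively link (w @ [z]) \<longleftrightarrow> successively link w"
      using p evL small by (intro successively_link_snoc) (auto simp: words_iff)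
    moreover have "z \<noteq> e"
    proof
      assume "z = e"
      obtain x where x: "x \<in> A" "even x" "x \<noteq> e" using other by auto
      then have "x \<in> set w" using p \<open>z = e\<close> by (auto simp: words_iff)
      then have "find even w \<noteq> None" using x by (auto simp: find_None_iff)
      then obtain y where y: "find even w = Some y" by auto
      then have "y = e" using p by (simp add: words_iff find_append)
      moreover have "y \<in> set w" using y by (auto simp: find_Some_iff)
      ultimately show False using p \<open>z = e\<close> by (auto simp: words_iff)
    qed
    ultimately have "w \<in> words (A - {z}) e"
      using p by (auto simp: words_iff find_append split: option.splits if_splits)
    then show "p \<in> (\<lambda>(z, w). (w @ [z], [])) ` (SIGMA z:L - {e}. words (A - {z}) e)"
      using p \<open>z \<noteq> e\<close> by (auto intro!: image_eqI[of _ _ "(z, w)"])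
  qed
  then have "card Z2 = card (SIGMA z:L - {e}. words (A - {z}) e)"
    by (rule bij_betw_same_card[symmetric])
  also have "\<dots> = (\<Sum>z\<in>L - {e}. card (words (A - {z}) e))"
    using finL by (intro card_SigmaI) auto
  finally have card2: "card Z2 = (\<Sum>z\<in>L - {e}. card (words (A - {z}) e))" .

  have "I = I0 \<union> Z1 \<union> Z2" by (auto simp: I0_def Z1_def Z2_def)
  moreover have "I0 \<inter> Z1 = {}" "(I0 \<union> Z1) \<inter> Z2 = {}" by (auto simp: I0_def Z1_def Z2_def)
  ultimately have "card I = card I0 + card Z1 + card Z2"
    using finI by (metis card_Un_disjoint finite_Un)
  \<comment> \<open>For each \<open>z\<close>, the \<open>card L - 1\<close> marks from
    \<open>Z1\<close> and the single end place from \<open>Z2\<close> add up to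
    \<open>card L\<close>.\<close>
  moreover have "card Z1 + card Z2 = (\<Sum>z\<in>L - {e}. card L * card (words (A - {z}) e))"
    unfolding card1 card2 sum.distrib[symmetric]
  proof (rule sum.cong)
    fix z assume "z \<in> L - {e}"
    then have "card L = Suc (card L - 1)" using finL card_gt_0_iff[of L] by auto
    then show "(card L - 1) * card (words (A - {z}) e) + card (words (A - {z}) e)
        = card L * card (words (A - {z}) e)"
      by (metis add.commute mult_Suc)
  qed auto
  ultimately show ?thesis using cardI card0 by simp
qed

section \<open>Interchangeability of the large even letters\<close>

lemma successively_map_iff:
  assumes "\<And>x y. x \<in> set xs \<Longrightarrow> y \<in> set xs \<Longrightarrow> P (h x) (h y) \<longleftrightarrow> P x y"
  shows "successively P (map h xs) \<longleftrightarrow> successively P xs"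
  using assms by (auto simp: successively_conv_nth)

lemma find_map_Some:
  assumes "\<And>x. x \<in> set xs \<Longrightarrow> P (h x) \<longleftrightarrow> P x"
  shows "find P (map h xs) = map_option h (find P xs)"
  using assms by (induction xs) auto

lemma card_words_relabel_le:
  assumes inj: "inj_on h A" and fin: "finite A"
    and ev: "\<And>x. x \<in> A \<Longrightarrow> even (h x) \<longleftrightarrow> even x"
    and link: "\<And>x y. x \<in> A \<Longrightarrow> y \<in> A \<Longrightarrow> link (h x) (h y) \<longleftrightarrow> link x y"
  shows "card (words A e) \<le> card (words (h ` A) (h e))"
proof (rule card_inj_on_le)
  show "inj_on (map h) (words A e)"
  proof (rule inj_on_mapI, rule inj_on_subset[OF inj])
    show "\<Union> (set ` words A e) \<subseteq> A" by (auto simp: words_iff)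
  qed
  show "map h ` words A e \<subseteq> words (h ` A) (h e)"
    using inj ev link by (auto simp: words_iff distinct_map successively_map_iff find_map_Some)
qed auto

text \<open>Two even letters are always linked, and an odd letter is below \<open>v\<close>, so its
  comparison with any letter from \<open>v\<close> on has a fixed outcome. Hence only the number of
  large letters matters, apart from the choice of the first even one.\<close>

lemma card_words_relabel:
  assumes fin: "finite A1" "finite A2" and e: "e1 \<in> A1" "e2 \<in> A2"
    and low: "{x \<in> A1. x < v} = {x \<in> A2. x < v}"
    and high: "\<And>x. x \<in> A1 \<union> A2 \<Longrightarrow> x \<ge> v \<Longrightarrow> even x"
    and card: "card A1 = card A2" and ee: "e1 = e2 \<or> e1 \<ge> v \<and> e2 \<ge> v"
  shows "card (words A1 e1) = card (words A2 e2)"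
proof -
  \<comment> \<open>The inequality is stated for all data so that it can also be applied with the
    two sides exchanged.\<close>
  have le: "card (words A1 e1) \<le> card (words A2 e2)"
    if fin: "finite A1" "finite A2" and e: "e1 \<in> A1" "e2 \<in> A2"
    and low: "{x \<in> A1. x < v} = {x \<in> A2. x < v}"
    and high: "\<And>x. x \<in> A1 \<union> A2 \<Longrightarrow> x \<ge> v \<Longrightarrow> even x"
    and card: "card A1 = card A2" and ee: "e1 = e2 \<or> e1 \<ge> v \<and> e2 \<ge> v" for A1 A2 e1 e2
  proof -
    let ?S1 = "insert e1 {x \<in> A1. x < v}" and ?S2 = "insert e2 {x \<in> A2. x < v}"
    have "card ?S1 = card ?S2"
    proof (cases "e1 = e2")
      case False
      then have "e1 \<notin> {x \<in> A1. x < v}" "e2 \<notin> {x \<in> A2. x < v}" using ee by auto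
      moreover have "finite {x \<in> A1. x < v}" "finite {x \<in> A2. x < v}" using fin by simp_all
      ultimately have "card ?S1 = Suc (card {x \<in> A1. x < v})" "card ?S2 = Suc (card {x \<in> A2. x < v})"
        by (blast intro: card_insert_disjoint)+
      then show ?thesis by (simp only: low)
    qed (simp only: low)
    moreover have "card (A1 - ?S1) = card A1 - card ?S1" "card (A2 - ?S2) = card A2 - card ?S2"
      using fin e by (auto intro!: card_Diff_subset)
    ultimately have "card (A1 - ?S1) = card (A2 - ?S2)"
      using card by simp
    then obtain g where g: "bij_betw g (A1 - ?S1) (A2 - ?S2)"
      using fin by (meson finite_Diff finite_same_card_bij)
    \<comment> \<open>Beyond \<open>e1\<close> and the letters below \<open>v\<close>, any bijection
      \<open>g\<close> will do, because the order among even letters is irrelevant.\<close>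
    define h where "h x = (if x = e1 then e2 else if x < v then x else g x)" for x
    have hS: "bij_betw h ?S1 ?S2"
      unfolding bij_betw_def
    proof
      show "inj_on h ?S1" using ee by (auto simp: inj_on_def h_def)
      have "h ` {x \<in> A1. x < v} = (\<lambda>x. x) ` {x \<in> A1. x < v}"
        using ee by (intro image_cong) (auto simp: h_def)
      moreover have "h e1 = e2" by (simp add: h_def)
      ultimately show "h ` ?S1 = ?S2" by (simp only: image_insert image_ident low)
    qed
    moreover have "bij_betw h (A1 - ?S1) (A2 - ?S2)"
      using g by (rule bij_betw_cong[THEN iffD1, rotated]) (auto simp: h_def)
    ultimately have "bij_betw h (?S1 \<union> (A1 - ?S1)) (?S2 \<union> (A2 - ?S2))"
      by (rule bij_betw_combine) auto
    moreover have "?S1 \<union> (A1 - ?S1) = A1" "?S2 \<union> (A2 - ?S2) = A2" using e by auto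
    ultimately have h: "bij_betw h A1 A2" by simp
    have hlow: "h x = x" if "x < v" for x
      using that ee by (auto simp: h_def)
    have hhigh: "h x \<ge> v" if "x \<in> A1" "x \<ge> v" for x
    proof (cases "x = e1")
      case True
      then show ?thesis using that ee by (auto simp: h_def)
    next
      case False
      then have "x \<in> A1 - ?S1" using that by auto
      then have "g x \<in> A2 - ?S2" using bij_betwE[OF g] by blast
      then show ?thesis using that False by (auto simp: h_def)
    qed
    have hA: "h x \<in> A2" if "x \<in> A1" for x using bij_betwE[OF h] that by blast
    have ev: "even (h x) \<longleftrightarrow> even x" if "x \<in> A1" for x
    proof (cases "x < v")
      case False
      then have "even x" "even (h x)"
        using that hhigh[of x] hA[of x] high[of x] high[of "h x"] by (simp_all add: not_less)
      then show ?thesis by simp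
    qed (simp add: hlow)
    have lk: "link (h x) (h y) \<longleftrightarrow> link x y" if "x \<in> A1" "y \<in> A1" for x y
    proof (cases "even x \<and> even y")
      case True
      then show ?thesis using that ev by (simp add: link_def)
    next
      case False
      have "x \<ge> v \<Longrightarrow> even x" "y \<ge> v \<Longrightarrow> even y" using that high by auto
      then have "x > y \<longleftrightarrow> h x > h y"
        using False that hlow[of x] hlow[of y] hhigh[of x] hhigh[of y]
        by (cases "x < v"; cases "y < v") auto
      then show ?thesis using that ev by (simp add: link_def)
    qed
    have "card (words A1 e1) \<le> card (words (h ` A1) (h e1))"
      using bij_betw_imp_inj_on[OF h] fin(1) ev lk by (rule card_words_relabel_le)
    moreover have "h ` A1 = A2" "h e1 = e2"
      using bij_betw_imp_surj_on[OF h] by (simp_all add: h_def)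
    ultimately show ?thesis by simp
  qed
  show ?thesis
  proof (rule antisym)
    show "card (words A1 e1) \<le> card (words A2 e2)"
      using assms by (intro le)
    show "card (words A2 e2) \<le> card (words A1 e1)"
      using assms(1-4) low[symmetric] card[symmetric] high ee
      by (intro le) (simp_all only: Un_commute, auto)
  qed
qed

section \<open>Recurrences in the number of odd letters\<close>

text \<open>\<open>N\<close> bounds the even letters and \<open>m\<close> is the number of odd ones, so that \<open>alphabet m m\<close> is \<open>{1..2m}\<close>.\<close>
definition alphabet :: "nat \<Rightarrow> nat \<Rightarrow> nat set" where
  "alphabet N m = {x \<in> {1..2 * N}. even x \<or> x < 2 * m}"

definition cnt :: "nat \<Rightarrow> nat \<Rightarrow> nat \<Rightarrow> nat" where
  "cnt N m j = card (words (alphabet N m) (2 * j))"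

lemma finite_alphabet [simp]: "finite (alphabet N m)"
  by (simp add: alphabet_def)

lemma alphabet_Suc: "m < N \<Longrightarrow> alphabet N (Suc m) = insert (2 * m + 1) (alphabet N m)"
  unfolding alphabet_def by (auto simp: less_Suc_eq)

lemma card_large_letters:
  assumes "m \<le> N"
  shows "card {x \<in> alphabet N m. x > 2 * m + 1} = N - m"
proof -
  have "{x \<in> alphabet N m. x > 2 * m + 1} = (\<lambda>i. 2 * i) ` {m<..N}"
    by (auto simp: alphabet_def elim!: evenE)
  then show ?thesis by (simp add: card_image inj_on_def)
qed

lemma card_alphabet: "m \<le> N \<Longrightarrow> card (alphabet N m) = N + m"
proof (induction m)
  case 0
  have "alphabet N 0 = (\<lambda>i. 2 * i) ` {1..N}"
    by (auto simp: alphabet_def elim!: evenE)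
  then show ?case by (simp add: card_image inj_on_def)
next
  case (Suc m)
  then have "2 * m + 1 \<notin> alphabet N m" by (auto simp: alphabet_def)
  with Suc show ?case by (simp add: alphabet_Suc)
qed

text \<open>All letters from \<open>2 * m\<close> on are even, hence interchangeable. A large
  \<open>j\<close> may become another \<open>j'\<close>, as it must when \<open>j = N\<close>
  exceeds the new bound.\<close>

lemma card_words_delete_large:
  assumes m: "1 \<le> m" "m < N" and z: "z \<in> alphabet N m" "z > 2 * m + 1" "z \<noteq> 2 * j"
    and j: "1 \<le> j" "j \<le> N" and j': "j' = j \<or> m < j \<and> m \<le> j'" "1 \<le> j'" "j' \<le> N - 1"
  shows "card (words (alphabet N m - {z}) (2 * j)) = cnt (N - 1) m j'"
  unfolding cnt_def
proof (rule card_words_relabel[where v = "2 * m"])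
  have "card (alphabet N m - {z}) = N + m - 1"
    using m z by (simp add: card_alphabet)
  then show "card (alphabet N m - {z}) = card (alphabet (N - 1) m)"
    using m by (simp add: card_alphabet)
qed (use assms in \<open>auto simp: alphabet_def\<close>)

lemma cnt_cong_large:
  assumes "1 \<le> m" "m \<le> j" "m \<le> j'" "j \<le> N" "j' \<le> N"
  shows "cnt N m j = cnt N m j'"
  unfolding cnt_def
  by (rule card_words_relabel[where v = "2 * m"]) (use assms in \<open>auto simp: alphabet_def\<close>)

text \<open>The new odd letter is \<open>2 * m + 1\<close>, with \<open>N - m\<close> letters above
  it. The term \<open>min j m\<close> keeps a first even letter up to \<open>2 * m\<close> and
  replaces a larger one by the interchangeable \<open>2 * m\<close>.\<close>

lemma cnt_insert_odd:
  assumes m: "1 \<le> m" "m < N" and j: "1 \<le> j" "j \<le> N"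
  shows "cnt N (Suc m) j + card ({x \<in> alphabet N m. x > 2 * m + 1} - {2 * j}) * ((N - m) * cnt (N - 1) m (min j m))
    = (N - m + 1) * cnt N m j"
proof -
  define L where "L = {x \<in> alphabet N m. x > 2 * m + 1}"
  have "\<exists>x\<in>alphabet N m. even x \<and> x \<noteq> 2 * j"
    \<comment> \<open>Both 2 and 4 are letters, since \<open>1 \<le> m\<close> and
      \<open>m < N\<close> give \<open>N \<ge> 2\<close>.\<close>
    using m by (intro bexI[of _ "if j = 1 then 4 else 2"]) (auto simp: alphabet_def)
  then have "card (words (insert (2 * m + 1) (alphabet N m)) (2 * j))
      + (\<Sum>z\<in>L - {2 * j}. card L * card (words (alphabet N m - {z}) (2 * j)))
     = (card L + 1) * card (words (alphabet N m) (2 * j))"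
    unfolding L_def by (intro card_words_insert_odd) (auto simp: alphabet_def)
  moreover have "(\<Sum>z\<in>L - {2 * j}. card L * card (words (alphabet N m - {z}) (2 * j)))
      = (\<Sum>z\<in>L - {2 * j}. (N - m) * cnt (N - 1) m (min j m))"
  proof (rule sum.cong)
    fix z assume "z \<in> L - {2 * j}"
    then have "card (words (alphabet N m - {z}) (2 * j)) = cnt (N - 1) m (min j m)"
      using m j by (intro card_words_delete_large) (auto simp: L_def min_def)
    then show "card L * card (words (alphabet N m - {z}) (2 * j)) = (N - m) * cnt (N - 1) m (min j m)"
      using m card_large_letters[of m N] by (simp add: L_def)
  qed auto
  ultimately show ?thesis
    using m card_large_letters[of m N] by (simp add: cnt_def alphabet_Suc L_def)
qed

text \<open>The first even letter is below the new odd letter, so each of the \<open>N - m\<close>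
  letters above it may be deleted.\<close>

lemma cnt_insert_odd_after:
  assumes "1 \<le> j" "j \<le> m" "m < N"
  shows "cnt N (Suc m) j + (N - m) * (N - m) * cnt (N - 1) m j = (N - m + 1) * cnt N m j"
proof -
  have "{x \<in> alphabet N m. x > 2 * m + 1} - {2 * j} = {x \<in> alphabet N m. x > 2 * m + 1}"
    using assms by auto
  then show ?thesis
    using cnt_insert_odd[of m N j] assms card_large_letters[of m N] by (simp add: min_def mult.assoc)
qed

text \<open>The first even letter is now above the new odd letter and must not be deleted, which
  lowers one factor by 1. Before the insertion it is interchangeable with \<open>2 * m\<close>, so
  the recurrence stays on the diagonal.\<close>

lemma cnt_insert_odd_before:
  assumes "1 \<le> m" "m < N"
  shows "cnt N (Suc m) (Suc m) + (N - Suc m) * (N - m) * cnt (N - 1) m m = (N - m + 1) * cnt N m m"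
proof -
  have "2 * Suc m \<in> {x \<in> alphabet N m. x > 2 * m + 1}"
    using assms by (auto simp: alphabet_def)
  then have "card ({x \<in> alphabet N m. x > 2 * m + 1} - {2 * Suc m}) = N - Suc m"
    using card_large_letters[of m N] assms by simp
  moreover have "cnt N m (Suc m) = cnt N m m"
    using assms by (intro cnt_cong_large) auto
  ultimately show ?thesis
    using cnt_insert_odd[of m N "Suc m"] assms by (simp add: min_def mult.assoc)
qed

text \<open>No letter can precede 1, as it would create a descent to an odd letter. Then 2 follows
  as the first even letter, and the other \<open>c\<close> even letters come in any order.\<close>

lemma cnt_base: "cnt (Suc c) 1 1 = fact c"
proof -
  define E where "E = alphabet (Suc c) 1 - {1, 2}"
  have A: "alphabet (Suc c) 1 = insert 1 (insert 2 E)" "1 \<notin> E" "2 \<notin> E"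
    by (auto simp: E_def alphabet_def)
  have evE: "even x" "x > 2" if "x \<in> E" for x
  proof -
    have "x \<noteq> 1" "x \<noteq> 2" "x \<ge> 1" "even x \<or> x < 2"
      using that by (auto simp: E_def alphabet_def)
    then show "even x" "x > 2" by auto
  qed
  have "words (alphabet (Suc c) 1) 2 = (\<lambda>w. 1 # 2 # w) ` permutations_of_set E"
  proof (intro equalityI subsetI)
    fix w assume w: "w \<in> words (alphabet (Suc c) 1) 2"
    then obtain us vs where us: "w = us @ 1 # vs" by (metis A(1) insertI1 split_list words_iff)
    have "us = []"
    proof (rule ccontr)
      assume "us \<noteq> []"
      then have "last us \<in> set us" "link (last us) 1"
        using w us by (auto simp: words_iff successively_append_iff)
      then have "last us \<in> alphabet (Suc c) 1" "last us \<noteq> 1" "link (last us) 1"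
        using w us by (auto simp: words_iff)
      then show False by (auto simp: link_def alphabet_def)
    qed
    have "insert 1 (set vs) = insert 1 (insert 2 E)" "1 \<notin> set vs" "distinct vs" "find even vs = Some 2"
      using w us \<open>us = []\<close> A by (auto simp: words_iff)
    moreover from this have "set vs = insert 2 E"
      using A by (simp add: insert_ident)
    ultimately have vs: "set vs = insert 2 E" "distinct vs" "find even vs = Some 2" by auto
    then obtain vs' where vs': "vs = 2 # vs'" using evE by (cases vs) (auto split: if_splits)
    then have "set vs' = E" "distinct vs'"
      using vs A insert_ident[of 2 "set vs'" E] by auto
    then show "w \<in> (\<lambda>w. 1 # 2 # w) ` permutations_of_set E"
      using us \<open>us = []\<close> vs' by (auto simp: permutations_of_set_def)
  next
    fix w assume "w \<in> (\<lambda>w. 1 # 2 # w) ` permutations_of_set E"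
    then obtain u where u: "w = 1 # 2 # u" "set u = E" "distinct u"
      by (auto simp: permutations_of_set_def)
    have "successively link u"
      using u evE by (auto simp: successively_conv_nth link_def)
    moreover have "u = [] \<or> 2 < hd u"
      using evE(2)[of "hd u"] u by (cases u) auto
    ultimately show "w \<in> words (alphabet (Suc c) 1) 2"
      using u A by (auto simp: words_iff successively_Cons link_def)
  qed
  moreover have finE: "finite E" by (simp add: E_def)
  moreover have "card (insert 1 (insert 2 E)) = Suc (Suc c)"
    unfolding A(1)[symmetric] by (simp add: card_alphabet)
  then have "card E = c" using finE A(2,3) by simp
  ultimately show ?thesis
    by (simp add: cnt_def card_image inj_on_def)
qed

section \<open>Operators describing the recurrences\<close>

text \<open>The argument \<open>c\<close> is the number of even letters above the odd letter inserted last,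
  not counting the smallest of them.\<close>
definition T :: "(nat \<Rightarrow> int) \<Rightarrow> nat \<Rightarrow> int" where
  "T u c = (int c + 2) * u (Suc c) - (int c + 1)^2 * u c"

definition S :: "(nat \<Rightarrow> int) \<Rightarrow> nat \<Rightarrow> int" where
  "S u c = (int c + 2) * u (Suc c) - (int c + 1) * int c * u c"

definition R :: "(nat \<Rightarrow> int) \<Rightarrow> nat \<Rightarrow> int" where
  "R u c = (int c + 1) * u c"

text \<open>The variable \<open>c\<close> is the surplus of even over odd letters: inserting an odd
  letter lowers it by 1, and deleting an even letter as well leaves a net change of 2 against one
  restored by comparing at the smaller bound, which is why \<open>S\<close> involves
  \<open>u (Suc c)\<close> and \<open>u c\<close>.\<close>

lemma cnt_eq_S_pow: "int (cnt (Suc m + c) (Suc m) (Suc m)) = (S ^^ m) fact c"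
proof (induction m arbitrary: c)
  case 0
  then show ?case using cnt_base[of c] by simp
next
  case (Suc m)
  have "int (cnt (Suc (Suc m) + c) (Suc (Suc m)) (Suc (Suc m)) + c * Suc c * cnt (Suc m + c) (Suc m) (Suc m))
      = int ((c + 2) * cnt (Suc m + Suc c) (Suc m) (Suc m))"
    using cnt_insert_odd_before[of "Suc m" "Suc (Suc m) + c"] by simp
  then show ?case
    unfolding of_nat_add of_nat_mult Suc.IH funpow.simps o_apply S_def[of "(S ^^ m) fact"]
    by (simp add: ac_simps eq_diff_eq)
qed

text \<open>The first even letter now stays fixed, and each of the \<open>i\<close> further odd
  letters lies above it and contributes one \<open>T\<close>.\<close>

lemma cnt_eq_T_pow: "int (cnt (Suc m + i + c) (Suc m + i) (Suc m)) = (T ^^ i) ((S ^^ m) fact) c"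
proof (induction i arbitrary: c)
  case 0
  then show ?case using cnt_eq_S_pow[of m c] by simp
next
  case (Suc i)
  have "int (cnt (Suc m + Suc i + c) (Suc m + Suc i) (Suc m) + Suc c * Suc c * cnt (Suc m + i + c) (Suc m + i) (Suc m))
      = int ((c + 2) * cnt (Suc m + i + Suc c) (Suc m + i) (Suc m))"
    using cnt_insert_odd_after[of "Suc m" "Suc m + i" "Suc m + Suc i + c"] by simp
  then show ?case
    unfolding of_nat_add of_nat_mult Suc.IH funpow.simps o_apply T_def[of "(T ^^ i) ((S ^^ m) fact)"]
    by (simp add: ac_simps power2_eq_square eq_diff_eq)
qed

lemma S_eq_T_plus_R: "S u = (\<lambda>c. T u c + R u c)"
  by (auto simp: S_def T_def R_def algebra_simps power2_eq_square)

lemma T_R: "T (R u) = (\<lambda>c. R (S u) c + T u c)"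
  by (auto simp: S_def T_def R_def algebra_simps power2_eq_square)

lemma T_add: "T (\<lambda>c. u c + v c) = (\<lambda>c. T u c + T v c)"
  by (auto simp: T_def algebra_simps)

lemma T_pow_add: "(T ^^ r) (\<lambda>c. u c + v c) = (\<lambda>c. (T ^^ r) u c + (T ^^ r) v c)"
  by (induction r) (auto simp: T_add)

text \<open>Moving \<open>R\<close> outwards past a \<open>T\<close> turns that \<open>T\<close>
  into an \<open>S\<close> inside and leaves a term without \<open>R\<close>. After the last move
  \<open>R\<close> acts at 0, where its factor is 1.\<close>

lemma T_pow_R: "(T ^^ r) (R u) 0 = (\<Sum>i\<le>r. (T ^^ i) ((S ^^ (r - i)) u) 0)"
proof (induction r arbitrary: u)
  case 0
  then show ?case by (simp add: R_def)
next
  case (Suc r)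
  have "(T ^^ Suc r) (R u) 0 = (T ^^ r) (R (S u)) 0 + (T ^^ Suc r) u 0"
    by (simp only: funpow_Suc_right o_apply T_R T_pow_add)
  also have "(T ^^ r) (R (S u)) 0 = (\<Sum>i\<le>r. (T ^^ i) ((S ^^ (Suc r - i)) u) 0)"
    unfolding Suc.IH by (intro sum.cong) (auto simp: Suc_diff_le funpow_Suc_right simp del: funpow.simps)
  finally show ?case by simp
qed

lemma T_fact: "T fact = R fact"
  by (rule ext) (simp add: T_def R_def algebra_simps power2_eq_square)

section \<open>Counting Dumont permutations\<close>

lemma dumont3_first_eq: "1 \<le> j \<Longrightarrow> dumont3_first m j = words {1..2 * m} (2 * j)"
  by (auto simp: dumont3_first_def dumont3_def words_def successively_conv_nth link_def)

lemma finite_dumont3_first [simp]: "finite (dumont3_first m j)"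
  by (cases "j = 0") (simp_all add: dumont3_first_def[of _ 0] dumont3_first_eq)

lemma card_dumont3_first:
  assumes "1 \<le> j" "j \<le> m"
  shows "int (card (dumont3_first m j)) = (T ^^ (m - j)) ((S ^^ (j - 1)) fact) 0"
proof -
  have "alphabet m m = {1..2 * m}" by (auto simp: alphabet_def order_le_less)
  then show ?thesis
    using cnt_eq_T_pow[of "j - 1" "m - j" 0] assms by (simp add: cnt_def dumont3_first_eq)
qed

lemma card_dumont3_first_Suc:
  assumes "k < n" "n \<ge> 2"
  shows "card (dumont3_first n (k + 1)) =
    card (dumont3_first n k) + (\<Sum>i=k..n - 1. card (dumont3_first (n - 1) i))"
proof -
  have sum: "(T ^^ (n - j - 1)) (R ((S ^^ (j - 1)) fact)) 0
      = int (\<Sum>i=j..n - 1. card (dumont3_first (n - 1) i))" if "1 \<le> j" "j < n" for j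
  proof -
    \<comment> \<open>The exponents \<open>n - j - 1 - i\<close> and \<open>j - 1\<close> of
      \<open>S\<close> add up to \<open>n - 2 - i\<close>.\<close>
    have "(T ^^ (n - j - 1)) (R ((S ^^ (j - 1)) fact)) 0
        = (\<Sum>i\<le>n - j - 1. (T ^^ i) ((S ^^ (n - 2 - i)) fact) 0)"
      unfolding T_pow_R using that by (intro sum.cong) (auto simp flip: funpow_add comp_apply[of "S ^^ _"])
    also have "\<dots> = (\<Sum>i=j..n - 1. int (card (dumont3_first (n - 1) i)))"
      \<comment> \<open>The summand with \<open>T ^^ i\<close> counts the words with first even
        letter \<open>2 * (n - 1 - i)\<close>.\<close>
      by (rule sum.reindex_bij_witness[of _ "\<lambda>i. n - 1 - i" "\<lambda>i. n - 1 - i"])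
        (use that in \<open>auto simp: card_dumont3_first\<close>)
    finally show ?thesis by simp
  qed
  have "int (card (dumont3_first n (k + 1))) =
    int (card (dumont3_first n k) + (\<Sum>i=k..n - 1. card (dumont3_first (n - 1) i)))"
  proof (cases "k = 0")
    case True
    \<comment> \<open>With no smaller even letter available, \<open>T_fact\<close> replaces the
      innermost \<open>T\<close> by \<open>R\<close>, and the sum for \<open>j = 1\<close>
      applies.\<close>
    have "(T ^^ (n - 1)) fact 0 = (T ^^ (n - 2)) (T fact) 0"
      using assms by (metis Suc_diff_Suc Suc_1 Suc_le_lessD comp_apply funpow_Suc_right)
    moreover have "(\<Sum>i=0..n - 1. card (dumont3_first (n - 1) i)) = (\<Sum>i=1..n - 1. card (dumont3_first (n - 1) i))"
      by (simp add: sum.atLeast_Suc_atMost dumont3_first_def[of _ 0])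
    ultimately show ?thesis
      using True assms sum[of 1] card_dumont3_first[of 1 n]
      by (simp add: T_fact dumont3_first_def[of _ 0] numeral_2_eq_2)
  next
    case False
    define q where "q = (S ^^ (k - 1)) fact"
    have "int (card (dumont3_first n (k + 1))) = (T ^^ (n - k - 1)) (S q) 0"
      using card_dumont3_first[of "k + 1" n] False assms unfolding q_def
      by (cases k) auto
    \<comment> \<open>The \<open>T\<close> part counts \<open>dumont3_first n k\<close>, the
      \<open>R\<close> part gives the sum over the shorter words.\<close>
    also have "\<dots> = (T ^^ (n - k - 1)) (T q) 0 + (T ^^ (n - k - 1)) (R q) 0"
      by (simp add: S_eq_T_plus_R T_pow_add)
    also have "(T ^^ (n - k - 1)) (T q) = (T ^^ (n - k)) q"
      using assms by (metis Suc_diff_Suc comp_apply funpow_Suc_right Suc_eq_plus1 diff_diff_left)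
    finally show ?thesis
      using card_dumont3_first[of k n] sum[of k] False assms by (simp add: q_def)
  qed
  then show ?thesis by linarith
qed

theorem theorem4p3:
  fixes n k :: nat
  assumes "n \<ge> 2" and "k < n"
  shows "\<exists>\<phi>. bij_betw \<phi> (dumont3_first n (k + 1))
           (dumont3_first n k \<union> (\<Union>i\<in>{k..n - 1}. dumont3_first (n - 1) i))"
proof (rule finite_same_card_bij)
  have "dumont3_first n k \<inter> (\<Union>i\<in>{k..n - 1}. dumont3_first (n - 1) i) = {}"
  proof -
    \<comment> \<open>The two parts of the union contain words of different lengths.\<close>
    have "length w = 2 * m" if "w \<in> dumont3_first m j" for w m j
      using that by (auto simp: dumont3_first_def dumont3_def permutations_of_set_def
          distinct_card[symmetric] split: if_splits)
    from this[of _ n k] this[of _ "n - 1"] show ?thesis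
      using assms by (fastforce simp: disjoint_iff)
  qed
  moreover have "card (\<Union>i\<in>{k..n - 1}. dumont3_first (n - 1) i)
      = (\<Sum>i=k..n - 1. card (dumont3_first (n - 1) i))"
    by (rule card_UN_disjoint) (simp_all, auto simp: dumont3_first_def)
  ultimately show "card (dumont3_first n (k + 1))
      = card (dumont3_first n k \<union> (\<Union>i\<in>{k..n - 1}. dumont3_first (n - 1) i))"
    using card_dumont3_first_Suc[OF assms(2,1)] by (simp add: card_Un_disjoint)
qed simp_all

end
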